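(* Let $q$ be an odd prime power and $\mathcal{P}$ a set of $8q^2$ points in $\mathbb{F}_q^3$. Then the number of distinct radii of spheres determined by $\mathcal{P}$ is at least $q/9$.
   Context: A sphere in $\mathbb{F}_q^3$ with center $(e_1,e_2,e_3)\in\mathbb{F}_q^3$ and radius $r\in\mathbb{F}_q$ is the set $\{(x,y,z)\in\mathbb{F}_q^3:(x-e_1)^2+(y-e_2)^2+(z-e_3)^2=r\}$. A sphere is determined by $\mathcal{P}$ if it passes through four non-coplanar points of $\mathcal{P}$. *)

theory Defs
  imports "HOL-Number_Theory.Prime_Powers" "HOL-Library.Cardinality"
begin

definition fq_sphere :: "'a::field \<times> 'a \<times> 'a \<Rightarrow> 'a \<Rightarrow> ('a \<times> 'a \<times> 'a) set" where
  "fq_sphere e r = (case e of (e1, e2, e3) \<Rightarrow>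
     {(x, y, z). (x - e1)\<^sup>2 + (y - e2)\<^sup>2 + (z - e3)\<^sup>2 = r})"

definition fq_plane :: "('a::field \<times> 'a \<times> 'a) set \<Rightarrow> bool" where
  "fq_plane H \<longleftrightarrow> (\<exists>a b c d. (a, b, c) \<noteq> (0, 0, 0) \<and> H = {(x, y, z). a * x + b * y + c * z = d})"

definition fq_coplanar :: "('a::field \<times> 'a \<times> 'a) set \<Rightarrow> bool" where
  "fq_coplanar S \<longleftrightarrow> (\<exists>H. fq_plane H \<and> S \<subseteq> H)"

definition determined_by :: "('a::field \<times> 'a \<times> 'a) set \<Rightarrow> ('a \<times> 'a \<times> 'a) set \<Rightarrow> bool" where
  "determined_by P C \<longleftrightarrow> (\<exists>T. T \<subseteq> P \<and> T \<subseteq> C \<and> card T = 4 \<and> \<not> fq_coplanar T)"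

definition determined_radii :: "('a::field \<times> 'a \<times> 'a) set \<Rightarrow> 'a set" where
  "determined_radii P = {r. \<exists>e. determined_by P (fq_sphere e r)}"

end

theory Submission
  imports Defs "HOL-Number_Theory.Residues" "HOL-Computational_Algebra.Polynomial"
begin

text \<open>
  Fix a centre \<open>e\<close>. If \<open>r\<close> is not a determined radius, then the points of \<open>P\<close> on the
  sphere of radius \<open>r\<close> around \<open>e\<close> are coplanar, hence lie on a conic, which has at most \<open>2q\<close>
  points. So at most \<open>2q\<^sup>2\<close> points of \<open>P\<close> lie on spheres around \<open>e\<close> of undetermined radius, and
  the remaining \<open>6q\<^sup>2\<close> points are at a determined distance from \<open>e\<close>. Counting pairs
  \<open>(e, p)\<close> at a determined distance and using that a sphere has at most \<open>2q\<^sup>2\<close> points gives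
  \<open>q\<^sup>3 \<cdot> 6q\<^sup>2 \<le> |R| \<cdot> 8q\<^sup>2 \<cdot> 2q\<^sup>2\<close> for the set \<open>R\<close> of determined radii.
\<close>

section \<open>Root counts and points on conics\<close>

text \<open>If 2 = 0, the characteristic is 2, and it divides the cardinality of the field.\<close>

lemma two_neq_zero_if_odd_card:
  assumes "odd CARD('a::{field,finite})"
  shows "(2::'a) \<noteq> 0"
proof
  assume "(2::'a) = 0"
  then have "of_nat 2 = (0::'a)" by simp
  then have "CHAR('a) dvd 2" by (simp only: of_nat_eq_0_iff_char_dvd)
  then have "CHAR('a) = 2"
    by (metis CHAR_not_1' One_nat_def prime_nat_iff two_is_prime_nat)
  then have "2 dvd CARD('a)" using CHAR_dvd_CARD[where 'a = 'a] by simp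
  then show False using assms by simp
qed

lemma card_quadratic_roots_le:
  fixes a b c :: "'a::field"
  assumes "a \<noteq> 0"
  shows "card {x. a * x\<^sup>2 + b * x + c = 0} \<le> 2"
proof -
  have "{x. a * x\<^sup>2 + b * x + c = 0} = {x. poly [:c, b, a:] x = 0}"
    by (auto simp: power2_eq_square algebra_simps)
  also have "card \<dots> \<le> degree [:c, b, a:]"
    using assms by (intro card_poly_roots_bound) simp
  also have "\<dots> = 2" using assms by simp
  finally show ?thesis .
qed

lemma card_linear_roots_le:
  fixes a b :: "'a::field"
  assumes "a \<noteq> 0"
  shows "card {x. a * x + b = 0} \<le> 1"
proof -
  have "{x. a * x + b = 0} \<subseteq> {- b / a}"
    using assms by (auto simp: field_simps add_eq_0_iff)
  then have "card {x. a * x + b = 0} \<le> card {- b / a}" by (rule card_mono[rotated]) simp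
  then show ?thesis by simp
qed

lemma card_Collect_pair:
  fixes Q :: "'a::finite \<Rightarrow> 'b::finite \<Rightarrow> bool"
  shows "card {(x, y). Q x y} = (\<Sum>x\<in>UNIV. card {y. Q x y})"
proof -
  have "{(x, y). Q x y} = (SIGMA x:UNIV. {y. Q x y})" by auto
  then show ?thesis by (simp add: card_SigmaI)
qed

text \<open>Slicing by lines parallel to an axis leaves at most 2 points per line on average. The
  slices are vertical unless \<open>B = C = 0\<close>; a nonzero quadratic part excludes the zero
  polynomial.\<close>

lemma card_conic_le:
  fixes A B C D E F :: "'a::{field,finite}"
  assumes "A \<noteq> 0 \<or> B \<noteq> 0 \<or> C \<noteq> 0"
  shows "card {(x, y). A * x\<^sup>2 + B * x * y + C * y\<^sup>2 + D * x + E * y + F = 0} \<le> 2 * CARD('a)"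
    (is "card ?K \<le> _")
proof -
  have K: "card ?K = (\<Sum>x\<in>UNIV. card {y. A * x\<^sup>2 + B * x * y + C * y\<^sup>2 + D * x + E * y + F = 0})"
    (is "_ = (\<Sum>x\<in>UNIV. card (?L x))")
    by (rule card_Collect_pair)
  show ?thesis
  proof (cases "C = 0")
    case False
    have "card (?L x) \<le> 2" for x
    proof -
      have "?L x = {y. C * y\<^sup>2 + (B * x + E) * y + (A * x\<^sup>2 + D * x + F) = 0}"
        by (simp add: algebra_simps)
      then show ?thesis using card_quadratic_roots_le[OF False] by simp
    qed
    then have "(\<Sum>x\<in>UNIV. card (?L x)) \<le> (\<Sum>x\<in>(UNIV::'a set). 2)" by (intro sum_mono)
    then show ?thesis using K by simp
  next
    case C: True
    show ?thesis
    proof (cases "B = 0")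
      case False
      \<comment> \<open>The only \<open>x\<close> at which the coefficient \<open>B * x + E\<close>
        of \<open>y\<close> vanishes. This one vertical line may lie wholly in the conic and costs
        up to q points; each other line costs at most 1.\<close>
      define x0 where "x0 = - E / B"
      have "card (?L x) \<le> 1" if "x \<noteq> x0" for x
      proof -
        have "B * x + E \<noteq> 0"
          using that False by (auto simp: x0_def field_simps add_eq_0_iff)
        moreover have "?L x = {y. (B * x + E) * y + (A * x\<^sup>2 + D * x + F) = 0}"
          using C by (simp add: algebra_simps)
        ultimately show ?thesis using card_linear_roots_le by metis
      qed
      then have "(\<Sum>x\<in>UNIV - {x0}. card (?L x)) \<le> (\<Sum>x\<in>UNIV - {x0}. 1)"
        by (intro sum_mono) auto
      also have "\<dots> \<le> CARD('a)" by (simp add: card_Diff_subset)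
      finally have "(\<Sum>x\<in>UNIV - {x0}. card (?L x)) \<le> CARD('a)" .
      moreover have "card (?L x0) \<le> CARD('a)" by (intro card_mono) auto
      moreover have "(\<Sum>x\<in>UNIV. card (?L x)) = card (?L x0) + (\<Sum>x\<in>UNIV - {x0}. card (?L x))"
        by (rule sum.remove) auto
      ultimately show ?thesis using K by linarith
    next
      case B: True
      have A: "A \<noteq> 0" using assms B C by simp
      \<comment> \<open>Vertical slices could now be full lines, so the slices are horizontal: for
        each \<open>y\<close> a quadratic in \<open>x\<close> with leading coefficient
        \<open>A\<close>.\<close>
      have "?K \<subseteq> (\<Union>y. (\<lambda>x. (x, y)) ` {x. A * x\<^sup>2 + D * x + (E * y + F) = 0})"
        using B C by (force simp: algebra_simps)
      then have "card ?K \<le> card (\<Union>y. (\<lambda>x. (x, y)) ` {x. A * x\<^sup>2 + D * x + (E * y + F) = 0})"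
        by (intro card_mono) auto
      also have "\<dots> \<le> (\<Sum>y\<in>UNIV. card ((\<lambda>x. (x, y)) ` {x. A * x\<^sup>2 + D * x + (E * y + F) = 0}))"
        by (intro card_UN_le) auto
      also have "\<dots> \<le> (\<Sum>y\<in>(UNIV::'a set). 2)"
        by (intro sum_mono order.trans[OF card_image_le] card_quadratic_roots_le[OF A]) auto
      finally show ?thesis by simp
    qed
  qed
qed

section \<open>Spheres and their plane sections\<close>

lemma card_sphere_le: "card (fq_sphere e (r::'a::{field,finite})) \<le> 2 * CARD('a)\<^sup>2"
proof -
  obtain e1 e2 e3 where e: "e = (e1, e2, e3)" by (cases e)
  have "card (fq_sphere e r) = card {(x, y, z). (x - e1)\<^sup>2 + (y - e2)\<^sup>2 + (z - e3)\<^sup>2 = r}"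
    by (simp add: fq_sphere_def e)
  also have "\<dots> = (\<Sum>x\<in>UNIV. \<Sum>y\<in>UNIV. card {z. (x - e1)\<^sup>2 + (y - e2)\<^sup>2 + (z - e3)\<^sup>2 = r})"
    by (simp add: card_Collect_pair case_prod_unfold[symmetric])
  also have "\<dots> \<le> (\<Sum>x\<in>(UNIV::'a set). \<Sum>y\<in>(UNIV::'a set). 2)"
  proof (intro sum_mono)
    fix x y
    have "{z. (x - e1)\<^sup>2 + (y - e2)\<^sup>2 + (z - e3)\<^sup>2 = r}
        = {z. 1 * z\<^sup>2 + (- 2 * e3) * z + ((x - e1)\<^sup>2 + (y - e2)\<^sup>2 + e3\<^sup>2 - r) = 0}"
      by (auto simp: power2_eq_square algebra_simps)
    then show "card {z. (x - e1)\<^sup>2 + (y - e2)\<^sup>2 + (z - e3)\<^sup>2 = r} \<le> 2"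
      using card_quadratic_roots_le[OF one_neq_zero] by (simp only:)
  qed
  also have "\<dots> = 2 * CARD('a)\<^sup>2" by (simp add: power2_eq_square)
  finally show ?thesis .
qed

text \<open>Since \<open>c \<noteq> 0\<close>, the plane is a graph over the (x, y)-plane, and
  eliminating \<open>z\<close> turns the section into a conic.\<close>

lemma card_sphere_Int_plane_le_aux:
  fixes a b c d e1 e2 e3 r :: "'a::{field,finite}"
  assumes "(2::'a) \<noteq> 0" "c \<noteq> 0"
  shows "card {(x, y, z). (x - e1)\<^sup>2 + (y - e2)\<^sup>2 + (z - e3)\<^sup>2 = r \<and> a * x + b * y + c * z = d}
    \<le> 2 * CARD('a)" (is "card ?S \<le> _")
proof -
  \<comment> \<open>Chosen so that \<open>z - e3 = \<alpha> * x + \<beta> * y + \<delta>\<close> on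
    the plane.\<close>
  define \<alpha> \<beta> \<delta> where "\<alpha> = - a / c" and "\<beta> = - b / c" and "\<delta> = d / c - e3"
  define K where "K = {(x, y). (1 + \<alpha>\<^sup>2) * x\<^sup>2 + (2 * \<alpha> * \<beta>) * x * y + (1 + \<beta>\<^sup>2) * y\<^sup>2
    + (2 * \<alpha> * \<delta> - 2 * e1) * x + (2 * \<beta> * \<delta> - 2 * e2) * y + (e1\<^sup>2 + e2\<^sup>2 + \<delta>\<^sup>2 - r) = 0}"
  \<comment> \<open>If the mixed coefficient vanishes, then \<alpha> or \<beta> is 0 because 2 is
    invertible, and the matching square coefficient is 1.\<close>
  have "1 + \<alpha>\<^sup>2 \<noteq> 0 \<or> 2 * \<alpha> * \<beta> \<noteq> 0 \<or> 1 + \<beta>\<^sup>2 \<noteq> 0"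
    using assms(1) by auto
  then have "card K \<le> 2 * CARD('a)" unfolding K_def by (rule card_conic_le)
  moreover have "?S \<subseteq> (\<lambda>(x, y). (x, y, \<alpha> * x + \<beta> * y + \<delta> + e3)) ` K"
  proof
    fix p
    assume "p \<in> ?S"
    then obtain x y z where p: "p = (x, y, z)"
      and h: "(x - e1)\<^sup>2 + (y - e2)\<^sup>2 + (z - e3)\<^sup>2 = r" "d = a * x + b * y + c * z"
      by auto
    have z: "z = \<alpha> * x + \<beta> * y + \<delta> + e3"
      using assms(2) h(2) by (simp add: \<alpha>_def \<beta>_def \<delta>_def field_simps)
    have "(x, y) \<in> K"
      using h(1) unfolding K_def z by (simp add: power2_eq_square algebra_simps)
    then show "p \<in> (\<lambda>(x, y). (x, y, \<alpha> * x + \<beta> * y + \<delta> + e3)) ` K"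
      using p z by force
  qed
  then have "card ?S \<le> card K" by (rule surj_card_le[rotated]) simp
  ultimately show ?thesis by simp
qed

text \<open>Permuting the coordinates moves a nonzero coefficient of the plane to the last place,
  which reduces all cases to the graph case.\<close>

lemma card_coplanar_subset_sphere_le:
  fixes S :: "('a::{field,finite} \<times> 'a \<times> 'a) set"
  assumes two: "(2::'a) \<noteq> 0" and "fq_coplanar S" "S \<subseteq> fq_sphere e r"
  shows "card S \<le> 2 * CARD('a)"
proof -
  obtain e1 e2 e3 where e: "e = (e1, e2, e3)" by (cases e)
  obtain a b c d where n: "(a, b, c) \<noteq> (0, 0, 0)" and S: "S \<subseteq> {(x, y, z). a * x + b * y + c * z = d}"
    using assms(2) by (auto simp: fq_coplanar_def fq_plane_def)
  have sub: "(x - e1)\<^sup>2 + (y - e2)\<^sup>2 + (z - e3)\<^sup>2 = r \<and> a * x + b * y + c * z = d"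
    if "(x, y, z) \<in> S" for x y z
    using that S assms(3) by (auto simp: e fq_sphere_def)
  consider "c \<noteq> 0" | "b \<noteq> 0" | "a \<noteq> 0" using n by auto
  then show ?thesis
  proof cases
    case 1
    have "S \<subseteq> {(x, y, z). (x - e1)\<^sup>2 + (y - e2)\<^sup>2 + (z - e3)\<^sup>2 = r \<and> a * x + b * y + c * z = d}"
      using sub by auto
    then have "card S \<le> card \<dots>" by (intro card_mono) auto
    then show ?thesis using card_sphere_Int_plane_le_aux[OF two 1] by (meson le_trans)
  next
    case 2
    have "S \<subseteq> (\<lambda>(x, z, y). (x, y, z)) `
        {(x, z, y). (x - e1)\<^sup>2 + (z - e3)\<^sup>2 + (y - e2)\<^sup>2 = r \<and> a * x + c * z + b * y = d}"
      using sub by (force simp: algebra_simps)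
    then have "card S \<le> card {(x, z, y). (x - e1)\<^sup>2 + (z - e3)\<^sup>2 + (y - e2)\<^sup>2 = r \<and> a * x + c * z + b * y = d}"
      by (rule surj_card_le[rotated]) simp
    then show ?thesis using card_sphere_Int_plane_le_aux[OF two 2] by (meson le_trans)
  next
    case 3
    have "S \<subseteq> (\<lambda>(y, z, x). (x, y, z)) `
        {(y, z, x). (y - e2)\<^sup>2 + (z - e3)\<^sup>2 + (x - e1)\<^sup>2 = r \<and> b * y + c * z + a * x = d}"
      using sub by (force simp: algebra_simps)
    then have "card S \<le> card {(y, z, x). (y - e2)\<^sup>2 + (z - e3)\<^sup>2 + (x - e1)\<^sup>2 = r \<and> b * y + c * z + a * x = d}"
      by (rule surj_card_le[rotated]) simp
    then show ?thesis using card_sphere_Int_plane_le_aux[OF two 3] by (meson le_trans)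
  qed
qed

section \<open>Four non-coplanar points in a non-coplanar set\<close>

lemma fq_coplanarI:
  fixes a b c :: "'a::field"
  assumes "a \<noteq> 0 \<or> b \<noteq> 0 \<or> c \<noteq> 0"
    and "\<And>x y z. (x, y, z) \<in> S \<Longrightarrow> a * (x - x0) + b * (y - y0) + c * (z - z0) = 0"
  shows "fq_coplanar S"
  unfolding fq_coplanar_def fq_plane_def
proof (intro exI conjI)
  show "(a, b, c) \<noteq> (0, 0, 0)" using assms(1) by auto
  show "S \<subseteq> {(x, y, z). a * x + b * y + c * z = a * x0 + b * y0 + c * z0}"
    using assms(2) by (auto simp: algebra_simps)
qed (rule refl)

text \<open>The determinant with rows \<open>u\<close>, \<open>v\<close>, \<open>w\<close>, expanded
  as the dot product of the cross product u x v with \<open>w\<close>.\<close>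

definition triple_product :: "'a::field \<times> 'a \<times> 'a \<Rightarrow> 'a \<times> 'a \<times> 'a \<Rightarrow> 'a \<times> 'a \<times> 'a \<Rightarrow> 'a" where
  "triple_product u v w = (case (u, v, w) of ((u1, u2, u3), (v1, v2, v3), (w1, w2, w3)) \<Rightarrow>
     (u2 * v3 - u3 * v2) * w1 + (u3 * v1 - u1 * v3) * w2 + (u1 * v2 - u2 * v1) * w3)"

text \<open>Cramer's rule: for n = (a, b, c), \<Delta> n = (n.u)(v x w) + (n.v)(w x u) + (n.w)(u x
  v).\<close>

lemma orthogonal_to_basis_eq_0:
  fixes a b c :: "'a::field"
  assumes "triple_product (u1, u2, u3) (v1, v2, v3) (w1, w2, w3) \<noteq> 0"
    and "a * u1 + b * u2 + c * u3 = 0" "a * v1 + b * v2 + c * v3 = 0" "a * w1 + b * w2 + c * w3 = 0"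
  shows "(a, b, c) = (0, 0, 0)"
proof -
  define \<Delta> where "\<Delta> = triple_product (u1, u2, u3) (v1, v2, v3) (w1, w2, w3)"
  note defs = \<Delta>_def triple_product_def
  have "\<Delta> * a = (v2 * w3 - v3 * w2) * (a * u1 + b * u2 + c * u3)
      + (w2 * u3 - w3 * u2) * (a * v1 + b * v2 + c * v3)
      + (u2 * v3 - u3 * v2) * (a * w1 + b * w2 + c * w3)"
    by (simp add: defs algebra_simps)
  moreover have "\<Delta> * b = (v3 * w1 - v1 * w3) * (a * u1 + b * u2 + c * u3)
      + (w3 * u1 - w1 * u3) * (a * v1 + b * v2 + c * v3)
      + (u3 * v1 - u1 * v3) * (a * w1 + b * w2 + c * w3)"
    by (simp add: defs algebra_simps)
  moreover have "\<Delta> * c = (v1 * w2 - v2 * w1) * (a * u1 + b * u2 + c * u3)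
      + (w1 * u2 - w2 * u1) * (a * v1 + b * v2 + c * v3)
      + (u1 * v2 - u2 * v1) * (a * w1 + b * w2 + c * w3)"
    by (simp add: defs algebra_simps)
  ultimately have "\<Delta> * a = 0" "\<Delta> * b = 0" "\<Delta> * c = 0"
    unfolding assms(2-4) by simp_all
  then show ?thesis using assms(1) by (simp add: \<Delta>_def)
qed

text \<open>Greedy choice: a point, a second point, a third off their line, a fourth off the plane
  of the three. If a choice failed, \<open>S\<close> would lie in a plane.\<close>

lemma not_coplanar_imp_4_points:
  fixes S :: "('a::field \<times> 'a \<times> 'a) set"
  assumes "\<not> fq_coplanar S"
  shows "\<exists>T\<subseteq>S. card T = 4 \<and> \<not> fq_coplanar T"
proof -
  obtain x0 y0 z0 where p0: "(x0, y0, z0) \<in> S"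
    using assms fq_coplanarI[of "1::'a" 0 0 S] by fastforce
  have "\<exists>x1 y1 z1. (x1, y1, z1) \<in> S \<and> (x1, y1, z1) \<noteq> (x0, y0, z0)"
    using assms fq_coplanarI[of "1::'a" 0 0 S x0] by fastforce
  then obtain x1 y1 z1 where p1: "(x1, y1, z1) \<in> S" "(x1, y1, z1) \<noteq> (x0, y0, z0)"
    by blast
  define u1 u2 u3 where u: "u1 = x1 - x0" "u2 = y1 - y0" "u3 = z1 - z0"
  have u0: "u1 \<noteq> 0 \<or> u2 \<noteq> 0 \<or> u3 \<noteq> 0" using p1(2) by (auto simp: u)
  \<comment> \<open>The three expressions are the coordinates of the cross product of u with (x -
    x0, y - y0, z - z0); all vanish exactly on the line through the first two points.\<close>
  have "\<exists>x y z. (x, y, z) \<in> S \<and> (u2 * (z - z0) - u3 * (y - y0) \<noteq> 0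
      \<or> u3 * (x - x0) - u1 * (z - z0) \<noteq> 0 \<or> u1 * (y - y0) - u2 * (x - x0) \<noteq> 0)"
  proof (rule ccontr)
    assume "\<not> ?thesis"
    then have *: "u2 * (z - z0) - u3 * (y - y0) = 0 \<and> u3 * (x - x0) - u1 * (z - z0) = 0
      \<and> u1 * (y - y0) - u2 * (x - x0) = 0" if "(x, y, z) \<in> S" for x y z
      using that by blast
    \<comment> \<open>Any nonzero normal orthogonal to u gives a plane containing that line; the
      case split keeps the chosen normal nonzero.\<close>
    have "fq_coplanar S"
    proof (cases "u1 = 0 \<and> u2 = 0")
      case True
      then have "u3 \<noteq> 0" using u0 by simp
      then show ?thesis
        by (intro fq_coplanarI[of u3 0 "- u1" S x0 y0 z0]) (use * in auto)
    next
      case False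
      then show ?thesis
        by (intro fq_coplanarI[of "- u2" u1 0 S x0 y0 z0]) (use * in auto)
    qed
    then show False using assms by simp
  qed
  then obtain x2 y2 z2 where p2: "(x2, y2, z2) \<in> S"
    and n0: "u2 * (z2 - z0) - u3 * (y2 - y0) \<noteq> 0
      \<or> u3 * (x2 - x0) - u1 * (z2 - z0) \<noteq> 0 \<or> u1 * (y2 - y0) - u2 * (x2 - x0) \<noteq> 0"
    by blast
  define v1 v2 v3 where v: "v1 = x2 - x0" "v2 = y2 - y0" "v3 = z2 - z0"
  \<comment> \<open>Otherwise \<open>S\<close> lies in the plane through the first point with normal
    u x v, which is nonzero by \<open>n0\<close>.\<close>
  have "\<exists>x y z. (x, y, z) \<in> S \<and> triple_product (u1, u2, u3) (v1, v2, v3) (x - x0, y - y0, z - z0) \<noteq> 0"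
    using assms fq_coplanarI[OF n0, of S x0 y0 z0]
    by (auto simp: triple_product_def v)
  then obtain x3 y3 z3 where p3: "(x3, y3, z3) \<in> S"
    and tp: "triple_product (u1, u2, u3) (v1, v2, v3) (x3 - x0, y3 - y0, z3 - z0) \<noteq> 0"
    by blast
  define T where "T = {(x0, y0, z0), (x1, y1, z1), (x2, y2, z2), (x3, y3, z3)}"
  have "T \<subseteq> S" using p0 p1 p2 p3 by (simp add: T_def)
  moreover have "card T = 4"
  proof -
    \<comment> \<open>Each coincidence makes one row of the determinant zero or two rows
      equal.\<close>
    have "(x2, y2, z2) \<noteq> (x0, y0, z0)" "(x3, y3, z3) \<noteq> (x0, y0, z0)" "(x2, y2, z2) \<noteq> (x1, y1, z1)"
      "(x3, y3, z3) \<noteq> (x1, y1, z1)" "(x3, y3, z3) \<noteq> (x2, y2, z2)"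
      using tp by (auto simp: triple_product_def u v algebra_simps)
    then show ?thesis using p1(2) unfolding T_def by (auto simp: card_insert_if)
  qed
  moreover have "\<not> fq_coplanar T"
  proof
    assume "fq_coplanar T"
    then obtain a b c d where n: "(a, b, c) \<noteq> (0, 0, 0)"
      and T: "T \<subseteq> {(x, y, z). a * x + b * y + c * z = d}"
      by (auto simp: fq_coplanar_def fq_plane_def)
    have "(a, b, c) = (0, 0, 0)"
      \<comment> \<open>Subtracting the plane equation at the first point makes the normal
        orthogonal to all three difference vectors.\<close>
      by (rule orthogonal_to_basis_eq_0[OF tp]) (use T in \<open>auto simp: T_def u v algebra_simps\<close>)
    then show False using n by simp
  qed
  ultimately show ?thesis by blast
qed

section \<open>Double counting of centres and points\<close>

lemma mem_fq_sphere_commute: "p \<in> fq_sphere e r \<longleftrightarrow> e \<in> fq_sphere p r"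
  by (auto simp: fq_sphere_def power2_commute split: prod.splits)

text \<open>The spheres around \<open>e\<close>, one for each radius in the field, partition the
  space.\<close>

lemma card_eq_sum_concentric_spheres:
  fixes P :: "('a::{field,finite} \<times> 'a \<times> 'a) set"
  shows "card P = (\<Sum>r\<in>UNIV. card (P \<inter> fq_sphere e r))"
proof -
  have "P = (\<Union>r. P \<inter> fq_sphere e r)"
    by (auto simp: fq_sphere_def split: prod.splits)
  also have "card \<dots> = (\<Sum>r\<in>UNIV. card (P \<inter> fq_sphere e r))"
    by (rule card_UN_disjoint) (auto simp: fq_sphere_def split: prod.splits)
  finally show ?thesis .
qed

theorem theorem1p14:
  fixes q :: nat and P :: "('a::{field,finite} \<times> 'a \<times> 'a) set"
  assumes "CARD('a) = q" and "primepow q" and "odd q"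
    and "card P = 8 * q\<^sup>2"
  shows "real (card (determined_radii P)) \<ge> real q / 9"
proof -
  define R where "R = determined_radii P"
  have two: "(2::'a) \<noteq> 0" using assms(1,3) two_neq_zero_if_odd_card by blast
  have q: "q > 0" using assms(3) by (rule odd_pos)
  have undetermined: "card (P \<inter> fq_sphere e r) \<le> 2 * q" if "r \<notin> R" for e r
  proof -
    have "fq_coplanar (P \<inter> fq_sphere e r)"
      using that not_coplanar_imp_4_points[of "P \<inter> fq_sphere e r"]
      unfolding R_def determined_radii_def determined_by_def by blast
    then show ?thesis
      using card_coplanar_subset_sphere_le[OF two] assms(1) by blast
  qed
  have pinned: "6 * q\<^sup>2 \<le> (\<Sum>r\<in>R. card (P \<inter> fq_sphere e r))" for e
  proof -
    have "(\<Sum>r\<in>UNIV - R. card (P \<inter> fq_sphere e r)) \<le> (\<Sum>r\<in>UNIV - R. 2 * q)"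
      using undetermined by (intro sum_mono) auto
    also have "\<dots> \<le> q * (2 * q)"
      using assms(1) card_mono[of "UNIV :: 'a set" "UNIV - R"] by simp
    finally have "(\<Sum>r\<in>UNIV - R. card (P \<inter> fq_sphere e r)) \<le> 2 * q\<^sup>2"
      by (simp add: power2_eq_square)
    moreover have "card P = (\<Sum>r\<in>UNIV - R. card (P \<inter> fq_sphere e r)) + (\<Sum>r\<in>R. card (P \<inter> fq_sphere e r))"
      unfolding card_eq_sum_concentric_spheres[of P e] by (rule sum.subset_diff) auto
    ultimately show ?thesis using assms(4) by linarith
  qed
  have "CARD('a \<times> 'a \<times> 'a) * (6 * q\<^sup>2)
      \<le> (\<Sum>e\<in>(UNIV :: ('a \<times> 'a \<times> 'a) set). \<Sum>r\<in>R. card (P \<inter> fq_sphere e r))"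
    using sum_mono[of "UNIV :: ('a \<times> 'a \<times> 'a) set" "\<lambda>_. 6 * q\<^sup>2", OF pinned] by simp
  also have "\<dots> = (\<Sum>r\<in>R. \<Sum>e\<in>UNIV. \<Sum>p\<in>P. of_bool (p \<in> fq_sphere e r))"
    by (subst sum.swap) (simp add: Int_def)
  \<comment> \<open>Symmetry of the distance lets the inner sum count the centres \<open>e\<close>
    on a sphere around the fixed point \<open>p\<close>.\<close>
  also have "\<dots> = (\<Sum>r\<in>R. \<Sum>p\<in>P. \<Sum>e\<in>UNIV. of_bool (e \<in> fq_sphere p r))"
    by (subst (2) sum.swap) (simp only: mem_fq_sphere_commute)
  also have "\<dots> = (\<Sum>r\<in>R. \<Sum>p\<in>P. card (fq_sphere p r))"
    by simp
  also have "\<dots> \<le> (\<Sum>r\<in>R. \<Sum>p\<in>P. 2 * q\<^sup>2)"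
    using card_sphere_le[where 'a = 'a] assms(1) by (intro sum_mono) simp
  also have "\<dots> = card R * (8 * q\<^sup>2 * (2 * q\<^sup>2))"
    using assms(4) by simp
  finally have "q * q * q * (6 * q\<^sup>2) \<le> card R * (8 * q\<^sup>2 * (2 * q\<^sup>2))"
    using assms(1) by (simp add: mult.assoc)
  \<comment> \<open>Factoring out \<open>2 * q ^ 4\<close> leaves |R| at least 3q/8, which exceeds
    q/9.\<close>
  then have "(2 * q ^ 4) * (3 * q) \<le> (2 * q ^ 4) * (8 * card R)"
    by (simp add: power2_eq_square power4_eq_xxxx algebra_simps)
  then have "3 * q \<le> 8 * card R" using q by simp
  then show ?thesis unfolding R_def by linarith
qed

end
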